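(* Let $(X,d)$ be a compact metric space and $T:X\to X$ a continuous map such that $(X,T)$ is a transitive dynamical system satisfying the property of weak expansion. Let $A\in C^0(X)$ be a Walters potential and $\varphi\in C^0(X,\mathbb R^n)$ a Walters constraint. Let $c\in\mathbb R^n$ and let $\{x_j\}_{j\ge0}\subset X$ be an optimal trajectory associated to the potential $A-\langle c,\varphi\rangle$. If $\alpha_{A,\varphi}$ is differentiable at $c$, then $$\lim_{k\to\infty}\frac1k\sum_{j=0}^{k-1}\varphi(x_j)=D\alpha_{A,\varphi}(c).$$
   Context: Weak expansion: the map $T^{-1}:\mathcal K(X)\to\mathcal K(X)$, $K\mapsto T^{-1}(K)$, is $1$-Lipschitz for the Hausdorff metric, where $\mathcal K(X)$ is the collection of nonempty compact subsets of $X$ (in particular pre-images of points are nonempty). Put $S_kf=\sum_{j=0}^{k-1}f\circ T^j$ and $d_k(x,y)=\max_{0\le j<k}d(T^j(x),T^j(y))$. A function $f\in C^0(X)$ is a Walters function (Walters potential) if there is an increasing function $H:\mathbb R^+\to\mathbb R^+\cup\{+\infty\}$, null and continuous at zero, such that for all $s\in\mathbb R^+$, $k>0$, $x,y\in X$: $d_k(x,y)\le s$ implies $|S_kf(x)-S_kf(y)|\le H(s)$. A Walters constraint is a $\varphi\in C^0(X,\mathbb R^n)$ whose coordinate functions are Walters functions. $\mathcal M_T$ is the set of $T$-invariant Borel probability measures; for $\varphi=(\varphi_1,\dots,\varphi_n)$, $\varphi_*(\mu)=\left(\int\varphi_1\,d\mu,\dots,\int\varphi_n\,d\mu\right)$.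 For $h\in\varphi_*(\mathcal M_T)$, $\beta_{A,\varphi}(h)=\sup\{\int A\,d\mu:\mu\in\mathcal M_T,\ \varphi_*(\mu)=h\}$; for $c\in\mathbb R^n$, $\alpha_{A,\varphi}(c)=\min_{h\in\varphi_*(\mathcal M_T)}[\langle c,h\rangle-\beta_{A,\varphi}(h)]$. $D\alpha_{A,\varphi}(c)$ is the differential, identified with the gradient vector in $\mathbb R^n$ via the Euclidean inner product $\langle\cdot,\cdot\rangle$. For $B\in C^0(X)$, $\beta_B=\max_{\mu\in\mathcal M_T}\int B\,d\mu$. A calibrated sub-action for $B$ is a function $u\in C^0(X)$ with $u(y)=\max_{T(x)=y}(B+u-\beta_B)(x)$ for all $y\in X$. For a calibrated sub-action $u$ for $B$, a sequence $\{x_j\}_{j\ge0}\subset X$ is an optimal trajectory (associated to the potential $B$) if $T(x_{j+1})=x_j$ and $u(x_j)=B(x_{j+1})+u(x_{j+1})-\beta_B$ for all $j\ge0$. (An optimal trajectory associated to $B$ means one for some calibrated sub-action for $B$.) *)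

theory Defs
  imports "HOL-Probability.Probability"
begin

section \<open>Dynamics on a compact metric space\<close>

text \<open>
  The compact metric space is a whole type \<open>'a::metric_space\<close> with \<open>compact (UNIV :: 'a set)\<close>.
  In particular it is nonempty.
\<close>

definition transitive_map :: "('a::topological_space \<Rightarrow> 'a) \<Rightarrow> bool" where
  "transitive_map T \<longleftrightarrow>
     (\<forall>U V. open U \<and> U \<noteq> {} \<and> open V \<and> V \<noteq> {} \<longrightarrow> (\<exists>n. (T ^^ n) ` U \<inter> V \<noteq> {}))"

definition nonempty_compacts :: "'a::topological_space set set" where
  "nonempty_compacts = {K. compact K \<and> K \<noteq> {}}"

definition hausdorff_dist :: "'a::metric_space set \<Rightarrow> 'a set \<Rightarrow> real" where
  "hausdorff_dist K L = max (SUP x\<in>K. infdist x L) (SUP y\<in>L. infdist y K)"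

definition weakly_expanding :: "('a::metric_space \<Rightarrow> 'a) \<Rightarrow> bool" where
  "weakly_expanding T \<longleftrightarrow>
     (\<forall>K\<in>nonempty_compacts. T -` K \<in> nonempty_compacts) \<and>
     (\<forall>K\<in>nonempty_compacts. \<forall>L\<in>nonempty_compacts.
        hausdorff_dist (T -` K) (T -` L) \<le> hausdorff_dist K L)"

definition birkhoff_sum :: "('a \<Rightarrow> 'a) \<Rightarrow> ('a \<Rightarrow> real) \<Rightarrow> nat \<Rightarrow> 'a \<Rightarrow> real" where
  "birkhoff_sum T f k x = (\<Sum>j<k. f ((T ^^ j) x))"

text \<open>Only used for \<open>k > 0\<close>; \<open>Max\<close> of the empty set is unspecified.\<close>

definition bowen_dist :: "('a::metric_space \<Rightarrow> 'a) \<Rightarrow> nat \<Rightarrow> 'a \<Rightarrow> 'a \<Rightarrow> real" where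
  "bowen_dist T k x y = Max ((\<lambda>j. dist ((T ^^ j) x) ((T ^^ j) y)) ` {..<k})"

text \<open>
  The modulus \<open>H\<close> takes values in \<open>[0, \<infinity>]\<close> and only its restriction to \<open>[0, \<infinity>)\<close> matters.
  \<open>Increasing\<close> is meant in the weak sense, since \<open>H\<close> may be constantly \<open>\<infinity>\<close> away from \<open>0\<close>.
\<close>

definition walters_function :: "('a::metric_space \<Rightarrow> 'a) \<Rightarrow> ('a \<Rightarrow> real) \<Rightarrow> bool" where
  "walters_function T f \<longleftrightarrow>
     continuous_on UNIV f \<and>
     (\<exists>H :: real \<Rightarrow> ennreal.
        mono_on {0..} H \<and> H 0 = 0 \<and> continuous (at 0 within {0..}) H \<and>
        (\<forall>s\<ge>0. \<forall>k>0. \<forall>x y. bowen_dist T k x y \<le> s \<longrightarrow>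
           ennreal \<bar>birkhoff_sum T f k x - birkhoff_sum T f k y\<bar> \<le> H s))"

definition walters_constraint ::
    "('a::metric_space \<Rightarrow> 'a) \<Rightarrow> ('a \<Rightarrow> real ^ 'n) \<Rightarrow> bool" where
  "walters_constraint T \<phi> \<longleftrightarrow>
     continuous_on UNIV \<phi> \<and> (\<forall>i. walters_function T (\<lambda>x. \<phi> x $ i))"

section \<open>Constrained ergodic optimization\<close>

definition invariant_probs :: "('a::topological_space \<Rightarrow> 'a) \<Rightarrow> 'a measure set" where
  "invariant_probs T =
     {\<mu>. sets \<mu> = sets borel \<and> prob_space \<mu> \<and>
         (\<forall>E\<in>sets borel. emeasure \<mu> (T -` E) = emeasure \<mu> E)}"

definition constraint_integral :: "('a \<Rightarrow> real ^ 'n) \<Rightarrow> 'a measure \<Rightarrow> real ^ 'n" where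
  "constraint_integral \<phi> \<mu> = (\<chi> i. integral\<^sup>L \<mu> (\<lambda>x. \<phi> x $ i))"

text \<open>
  On a compact space the set of invariant probability measures is nonempty and weak-* compact,
  so the maximum and minimum in the usual definitions of \<open>ergodic_max\<close> and \<open>constrained_alpha\<close>
  are attained and equal to the supremum and infimum below.
\<close>

definition ergodic_max :: "('a::topological_space \<Rightarrow> 'a) \<Rightarrow> ('a \<Rightarrow> real) \<Rightarrow> real" where
  "ergodic_max T B = (SUP \<mu>\<in>invariant_probs T. integral\<^sup>L \<mu> B)"

definition constrained_beta ::
    "('a::topological_space \<Rightarrow> 'a) \<Rightarrow> ('a \<Rightarrow> real) \<Rightarrow> ('a \<Rightarrow> real ^ 'n) \<Rightarrow> real ^ 'n \<Rightarrow> real" where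
  "constrained_beta T A \<phi> h =
     (SUP \<mu>\<in>{\<mu> \<in> invariant_probs T. constraint_integral \<phi> \<mu> = h}. integral\<^sup>L \<mu> A)"

definition constrained_alpha ::
    "('a::topological_space \<Rightarrow> 'a) \<Rightarrow> ('a \<Rightarrow> real) \<Rightarrow> ('a \<Rightarrow> real ^ 'n) \<Rightarrow> real ^ 'n \<Rightarrow> real" where
  "constrained_alpha T A \<phi> c =
     (INF h\<in>constraint_integral \<phi> ` invariant_probs T. c \<bullet> h - constrained_beta T A \<phi> h)"

section \<open>Calibrated sub-actions and optimal trajectories\<close>

text \<open>The two clauses for \<open>y\<close> say that \<open>u y\<close> is the maximum, attained, over the fibre of \<open>y\<close>.\<close>

definition calibrated_subaction ::
    "('a::topological_space \<Rightarrow> 'a) \<Rightarrow> ('a \<Rightarrow> real) \<Rightarrow> ('a \<Rightarrow> real) \<Rightarrow> bool" where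
  "calibrated_subaction T B u \<longleftrightarrow>
     continuous_on UNIV u \<and>
     (\<forall>y. (\<exists>x. T x = y \<and> u y = B x + u x - ergodic_max T B) \<and>
          (\<forall>x. T x = y \<longrightarrow> B x + u x - ergodic_max T B \<le> u y))"

definition optimal_trajectory ::
    "('a::topological_space \<Rightarrow> 'a) \<Rightarrow> ('a \<Rightarrow> real) \<Rightarrow> (nat \<Rightarrow> 'a) \<Rightarrow> bool" where
  "optimal_trajectory T B x \<longleftrightarrow>
     (\<exists>u. calibrated_subaction T B u \<and>
          (\<forall>j. T (x (Suc j)) = x j \<and>
               u (x j) = B (x (Suc j)) + u (x (Suc j)) - ergodic_max T B))"

section \<open>Gradients\<close>

definition gradient :: "('v::real_inner \<Rightarrow> real) \<Rightarrow> 'v \<Rightarrow> 'v" where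
  "gradient f c = (THE D. GDERIV f c :> D)"

lemma gradient_eqI:
  assumes "GDERIV f c :> D"
  shows "gradient f c = D"
  unfolding gradient_def
proof (rule the_equality)
  show "GDERIV f c :> D" by (rule assms)
next
  fix E assume "GDERIV f c :> E"
  then have "(\<lambda>h. inner h E) = (\<lambda>h. inner h D)"
    using assms unfolding gderiv_def by (rule has_derivative_unique)
  then have "inner h E = inner h D" for h by (rule fun_cong)
  then show "E = D" by (metis vector_eq_ldot)
qed

lemma GDERIV_gradient:
  fixes f :: "'v::euclidean_space \<Rightarrow> real"
  assumes "f differentiable (at c)"
  shows "GDERIV f c :> gradient f c"
proof -
  obtain f' where f': "(f has_derivative f') (at c)"
    using assms unfolding differentiable_def by blast
  then have "linear f'" by (rule has_derivative_linear)
  then have "inner h (adjoint f' 1) = f' h" for h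
    by (simp add: adjoint_works)
  then have "GDERIV f c :> adjoint f' 1"
    using f' by (simp add: gderiv_def)
  then show ?thesis by (simp add: gradient_eqI)
qed

end

theory Submission
  imports Defs
begin

text \<open>
  Write \<open>\<alpha>\<close> for \<open>constrained_alpha T A \<phi>\<close> and \<open>B\<close> for \<open>A - c \<bullet> \<phi>\<close>. The proof rests on two facts.

  First, \<open>\<alpha> c\<close> is minus the ergodic maximum of \<open>B\<close> (\<open>constrained_alpha_eq_ergodic_max\<close>). So \<open>\<alpha>\<close>
  is concave, and if an invariant probability \<open>\<mu>\<close> maximizes the integral of \<open>B\<close>, then the vector of
  integrals of \<open>\<phi>\<close> under \<open>\<mu>\<close> is a supergradient of \<open>\<alpha>\<close> at \<open>c\<close>. Where \<open>\<alpha>\<close> is differentiable its only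
  supergradient is the gradient, hence all maximizing measures give \<open>\<phi>\<close> the same integral, namely
  the gradient (\<open>maximizing_integral_eq_gradient\<close>).

  Second, every weak limit of the empirical measures of an optimal trajectory is invariant, because
  the trajectory is a backward orbit, and maximizing, because \<open>B\<close> equals the constant
  \<open>ergodic_max T B\<close> plus a coboundary along the trajectory (\<open>optimal_trajectory_limit_maximizing\<close>).

  Such weak limits exist along a subsequence of any given subsequence
  (\<open>weakly_convergent_subsequence\<close>), so every subsequence of the averages of \<open>\<phi>\<close> has a further
  subsequence converging to the gradient, and the whole sequence converges. The weak compactness of
  the probability measures on a compact metric space is reduced to Helly's theorem on the real line
  by writing the space as a continuous image of a compact subset of the Cantor set
  (\<open>compact_metric_image_of_real_compact\<close>).
\<close>

section \<open>Compact metric spaces as images of compact sets of reals\<close>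

text \<open>
  The classical embedding of the binary sequences onto the middle-thirds Cantor set. Base 3 is
  used because base 2 would identify the two expansions of a dyadic rational.
\<close>

definition cantor_point :: "(nat \<Rightarrow> bool) \<Rightarrow> real" where
  "cantor_point b = (\<Sum>n. (if b n then 2 else 0) / 3 ^ Suc n)"

lemma summable_thirds: "summable (\<lambda>n. 2 / 3 ^ Suc n :: real)"
  using summable_mult[OF summable_geometric[of "1/3::real"], of "2/3"]
  by (simp add: power_divide field_simps)

lemma suminf_thirds: "(\<Sum>n. 2 / 3 ^ Suc n :: real) = 1"
  using suminf_mult[OF summable_geometric[of "1/3::real"], of "2/3"] suminf_geometric[of "1/3::real"]
  by (simp add: power_divide field_simps)

lemma summable_cantor_point: "summable (\<lambda>n. (if b n then 2 else 0) / 3 ^ Suc n :: real)"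
  by (rule summable_comparison_test'[OF summable_thirds]) auto

lemma cantor_point_nonneg: "0 \<le> cantor_point b"
  unfolding cantor_point_def by (intro suminf_nonneg summable_cantor_point) auto

lemma cantor_point_le_1: "cantor_point b \<le> 1"
  unfolding cantor_point_def suminf_thirds[symmetric]
  by (intro suminf_le summable_cantor_point summable_thirds) auto

text \<open>
  The self-similarity of the Cantor set: the leading digit decides between the lower and the upper
  third of the unit interval, and the remaining digits give the position inside it.
\<close>

lemma cantor_point_shift:
  "cantor_point b = ((if b 0 then 2 else 0) + cantor_point (\<lambda>n. b (Suc n))) / 3"
proof -
  have "cantor_point b = (\<Sum>n. (if b (Suc n) then 2 else 0) / 3 ^ Suc (Suc n)) + (if b 0 then 2 else 0) / 3"
    unfolding cantor_point_def by (subst suminf_split_head[OF summable_cantor_point]) simp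
  also have "(\<Sum>n. (if b (Suc n) then 2 else 0) / 3 ^ Suc (Suc n) :: real)
      = (\<Sum>n. (1/3) * ((if b (Suc n) then 2 else 0) / 3 ^ Suc n))"
    by (intro suminf_cong) simp
  also have "\<dots> = (1/3) * cantor_point (\<lambda>n. b (Suc n))"
    unfolding cantor_point_def by (rule suminf_mult[OF summable_cantor_point])
  finally show ?thesis by (simp add: field_simps)
qed

lemma inj_cantor_point: "inj cantor_point"
proof (rule injI)
  fix b b' assume "cantor_point b = cantor_point b'"
  then have "b n = b' n" for n
  proof (induction n arbitrary: b b')
    case 0
    then show ?case
      using cantor_point_shift[of b] cantor_point_shift[of b']
        cantor_point_nonneg[of "\<lambda>n. b (Suc n)"] cantor_point_le_1[of "\<lambda>n. b (Suc n)"]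
        cantor_point_nonneg[of "\<lambda>n. b' (Suc n)"] cantor_point_le_1[of "\<lambda>n. b' (Suc n)"]
      by (auto split: if_splits)
  next
    case (Suc n)
    have "cantor_point (\<lambda>n. b (Suc n)) = cantor_point (\<lambda>n. b' (Suc n))"
      using Suc.prems cantor_point_shift[of b] cantor_point_shift[of b']
        cantor_point_nonneg[of "\<lambda>n. b (Suc n)"] cantor_point_le_1[of "\<lambda>n. b (Suc n)"]
        cantor_point_nonneg[of "\<lambda>n. b' (Suc n)"] cantor_point_le_1[of "\<lambda>n. b' (Suc n)"]
      by (auto split: if_splits)
    from Suc.IH[OF this] show ?case .
  qed
  then show "b = b'" by (rule ext)
qed

lemma continuous_on_cantor_point: "continuous_on UNIV cantor_point"
proof -
  have digit: "continuous_on UNIV (\<lambda>b::nat \<Rightarrow> bool. (if b n then 2 else 0) / 3 ^ Suc n :: real)" for n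
  proof -
    have "continuous_on UNIV (\<lambda>c::bool. (if c then 2 else 0) / 3 ^ Suc n :: real)"
      by (simp add: continuous_on_open_vimage open_discrete)
    moreover have "continuous_on UNIV (\<lambda>b::nat \<Rightarrow> bool. b n)"
      by (rule continuous_on_product_then_coordinatewise) (rule continuous_on_id)
    ultimately show ?thesis
      by (rule continuous_on_compose2) auto
  qed
  have "uniform_limit UNIV (\<lambda>n b. \<Sum>i<n. (if b i then 2 else 0) / 3 ^ Suc i :: real)
      (\<lambda>b. \<Sum>i. (if b i then 2 else 0) / 3 ^ Suc i) sequentially"
    by (rule Weierstrass_m_test[OF _ summable_thirds]) auto
  then have "continuous_on UNIV (\<lambda>b. \<Sum>i. (if b i then 2 else 0) / 3 ^ Suc i :: real)"
    by (rule uniform_limit_theorem[rotated]) (auto intro!: always_eventually continuous_on_sum digit simp del: power_Suc)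
  then show ?thesis
    by (simp add: cantor_point_def[abs_def])
qed

lemma compact_UNIV_binary_sequences: "compact (UNIV :: (nat \<Rightarrow> bool) set)"
proof -
  have "compact_space (product_topology (\<lambda>i::nat. euclidean :: bool topology) UNIV)"
    by (subst compact_space_product_topology) (simp add: compact_space_def finite_imp_compact)
  then show ?thesis
    by (simp add: euclidean_product_topology compact_space_def)
qed

text \<open>
  Total boundedness at the scales \<open>1 / (m + 1)\<close> gives a finite net of balls for each \<open>m\<close>; together
  they form one countable list, in which every point lies in balls of arbitrarily small radius.
\<close>

lemma compact_metric_countable_balls:
  assumes "compact (UNIV :: 'a::metric_space set)"
  obtains r :: "nat \<Rightarrow> real" and p :: "nat \<Rightarrow> 'a::metric_space"
  where "\<forall>n. 0 < r n" "\<forall>x. \<forall>e>0. \<exists>n. r n < e \<and> dist x (p n) < r n"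
proof -
  have "\<forall>m. \<exists>k::'a set. finite k \<and> UNIV \<subseteq> (\<Union>x\<in>k. ball x (inverse (real (Suc m))))"
    using seq_compact_imp_totally_bounded[of "UNIV :: 'a set"] assms
    by (metis compact_imp_seq_compact inverse_positive_iff_positive of_nat_0_less_iff zero_less_Suc)
  then obtain K :: "nat \<Rightarrow> 'a set" where fin: "\<And>m. finite (K m)"
    and cover: "\<And>m. UNIV \<subseteq> (\<Union>x\<in>K m. ball x (inverse (real (Suc m))))"
    by metis
  define P where "P = (\<Union>m. K m \<times> {inverse (real (Suc m))})"
  have count: "countable P"
    unfolding P_def using fin by (intro countable_UN) (auto intro: countable_finite)
  have near: "\<exists>q\<in>P. snd q < e \<and> dist x (fst q) < snd q" if "0 < e" for x e
  proof -
    obtain m where m: "inverse (real (Suc m)) < e" using reals_Archimedean[OF \<open>0 < e\<close>] by blast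
    obtain y where y: "y \<in> K m" "x \<in> ball y (inverse (real (Suc m)))"
      using cover[of m] by blast
    show ?thesis
    proof (intro bexI conjI)
      show "(y, inverse (real (Suc m))) \<in> P" using y(1) by (auto simp: P_def)
    qed (use m y(2) in \<open>simp_all add: dist_commute\<close>)
  qed
  then have ne: "P \<noteq> {}" by (metis empty_iff zero_less_one)
  have P: "from_nat_into P n \<in> P" for n using ne by (rule from_nat_into)
  show ?thesis
  proof
    have "0 < snd q" if "q \<in> P" for q
      using that by (auto simp: P_def)
    then show "\<forall>n. 0 < snd (from_nat_into P n)"
      using P by blast
    show "\<forall>x. \<forall>e>0. \<exists>n. snd (from_nat_into P n) < e \<and>
        dist x (fst (from_nat_into P n)) < snd (from_nat_into P n)"
      using near from_nat_into_surj[OF count] by metis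
  qed
qed

text \<open>
  Every compact metric space is a continuous image of a compact set \<open>C\<close> of reals, with a Borel
  section \<open>e\<close>. A point is coded by binary answers to the questions whether it is near the centre of
  the \<open>n\<close>-th ball. A sharp threshold would not give a closed condition, so the answers are made to
  overlap: 0 is admissible up to distance \<open>2 * r n\<close>, and 1 from distance \<open>r n\<close> on. The relation
  between codes and points is then closed, hence compact; every point has a code, and a code still
  determines its point, because two points that are far apart compared with a small ball around
  one of them cannot share the answer for that ball. Thus decoding is the inverse of a continuous
  injection on a compact set, hence continuous. Answering by \<open>r n < dist x (p n)\<close> is a Borel choice.
\<close>

lemma compact_metric_image_of_real_compact:
  assumes cpt: "compact (UNIV :: 'a::metric_space set)"
  obtains C :: "real set" and g :: "real \<Rightarrow> 'a::metric_space" and e :: "'a \<Rightarrow> real"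
  where "compact C" "C \<subseteq> {0..1}" "continuous_on C g" "e \<in> borel_measurable borel"
    "\<forall>x. e x \<in> C" "\<forall>x. g (e x) = x"
proof -
  obtain r :: "nat \<Rightarrow> real" and p :: "nat \<Rightarrow> 'a" where r: "\<forall>n. 0 < r n"
    and near: "\<forall>x. \<forall>e>0. \<exists>n. r n < e \<and> dist x (p n) < r n"
    using compact_metric_countable_balls[OF cpt] .
  define R where "R = {q :: (nat \<Rightarrow> bool) \<times> 'a.
    \<forall>n. (fst q n \<or> dist (snd q) (p n) \<le> 2 * r n) \<and> (\<not> fst q n \<or> r n \<le> dist (snd q) (p n))}"
  have "closed R"
  proof -
    have bit: "continuous_on UNIV (\<lambda>q :: (nat \<Rightarrow> bool) \<times> 'a. fst q n)" for n
      by (rule continuous_on_product_then_coordinatewise) (intro continuous_intros)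
    have "closed ((\<lambda>q :: (nat \<Rightarrow> bool) \<times> 'a. fst q n) -` {v})" for n v
      by (rule closed_vimage[OF _ bit]) simp
    from this[of _ True] this[of _ False]
    have "closed {q :: (nat \<Rightarrow> bool) \<times> 'a. fst q n}" "closed {q :: (nat \<Rightarrow> bool) \<times> 'a. \<not> fst q n}" for n
      by (auto simp: vimage_def)
    then show ?thesis
      unfolding R_def by (intro closed_Collect_all closed_Collect_conj closed_Collect_disj closed_Collect_le
        continuous_intros)
  qed
  then have "compact R"
    using closed_Int_compact[OF _ compact_Times[OF compact_UNIV_binary_sequences cpt]] by simp
  have unique: "x = y" if "(b, x) \<in> R" "(b, y) \<in> R" for b x y
  proof (rule ccontr)
    assume "x \<noteq> y"
    then obtain n where n: "r n < dist x y / 3" "dist x (p n) < r n"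
      using near[rule_format, of "dist x y / 3" x] by auto
    with that have "dist y (p n) \<le> 2 * r n"
      unfolding R_def by force
    with n dist_triangle2[of x y "p n"] show False by linarith
  qed
  define F where "F q = cantor_point (fst q)" for q :: "(nat \<Rightarrow> bool) \<times> 'a"
  have F: "continuous_on R F"
    unfolding F_def
    by (rule continuous_on_compose2[OF continuous_on_cantor_point]) (auto intro: continuous_intros)
  have "inj_on F R"
    using unique by (auto simp: inj_on_def F_def dest!: injD[OF inj_cantor_point])
  then have inv: "\<forall>q\<in>R. inv_into R F (F q) = q"
    by simp
  define e where "e x = cantor_point (\<lambda>n. r n < dist x (p n))" for x
  have inR: "(\<lambda>n. r n < dist x (p n), x) \<in> R" for x
  proof -
    have "dist x (p n) \<le> 2 * r n" if "\<not> r n < dist x (p n)" for n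
      using that r[rule_format, of n] by linarith
    then show ?thesis by (auto simp: R_def)
  qed
  have eF: "e x = F (\<lambda>n. r n < dist x (p n), x)" for x
    by (simp add: e_def F_def)
  show ?thesis
  proof
    show "compact (F ` R)" by (rule compact_continuous_image[OF F \<open>compact R\<close>])
    show "F ` R \<subseteq> {0..1}" by (auto simp: F_def cantor_point_nonneg cantor_point_le_1)
    show "continuous_on (F ` R) (snd \<circ> inv_into R F)"
      by (intro continuous_on_compose continuous_on_inv[OF F \<open>compact R\<close> inv] continuous_on_snd continuous_on_id)
    show "e \<in> borel_measurable borel"
    proof -
      have [measurable]: "(\<lambda>x. dist x (p n)) \<in> borel_measurable borel" for n
        by (intro borel_measurable_continuous_onI continuous_intros)
      show ?thesis unfolding e_def cantor_point_def by measurable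
    qed
    show "\<forall>x. e x \<in> F ` R" unfolding eF using inR by blast
    show "\<forall>x. (snd \<circ> inv_into R F) (e x) = x" using inv inR by (simp add: eF)
  qed
qed

section \<open>Weak compactness of Borel probability measures\<close>

text \<open>
  Sequential compactness of the Borel probability measures on a compact metric space. The measures
  are lifted along the section \<open>e\<close> to the compact set \<open>C\<close> of reals, where Helly's selection theorem
  applies. The limit is again concentrated on the closed set \<open>C\<close> and is pushed back along \<open>g\<close>.
  A continuous \<open>f\<close> on the space becomes \<open>f \<circ> g\<close> on \<open>C\<close>, which Tietze's theorem extends to a bounded
  continuous test function on the whole line.
\<close>

lemma weakly_convergent_subsequence:
  fixes M :: "nat \<Rightarrow> 'a::metric_space measure"
  assumes cpt: "compact (UNIV :: 'a set)"
    and prob: "\<And>n. prob_space (M n)" and sets: "\<And>n. sets (M n) = sets borel"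
  obtains s \<mu> where "strict_mono (s :: nat \<Rightarrow> nat)" "prob_space \<mu>" "sets \<mu> = sets borel"
    "\<And>f :: 'a \<Rightarrow> real. continuous_on UNIV f \<Longrightarrow>
       (\<lambda>n. integral\<^sup>L (M (s n)) f) \<longlonglongrightarrow> integral\<^sup>L \<mu> f"
proof -
  obtain C :: "real set" and g :: "real \<Rightarrow> 'a" and e :: "'a \<Rightarrow> real"
    where C: "compact C" "C \<subseteq> {0..1}" and g: "continuous_on C g"
      and e_borel: "e \<in> borel_measurable borel" and eC: "\<forall>x. e x \<in> C" and ge: "\<forall>x. g (e x) = x"
    using compact_metric_image_of_real_compact[OF cpt] .
  have e[measurable]: "e \<in> borel_measurable (M n)" for n
    using e_borel measurable_cong_sets[OF sets refl] by blast
  have spaceM: "space (M n) = UNIV" for n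
    using sets_eq_imp_space_eq[OF sets] by simp
  have "closed C" "C \<noteq> {}"
    using C eC by (auto intro: compact_imp_closed)
  define N where "N n = distr (M n) borel e" for n
  have realN: "real_distribution (N n)" for n
    unfolding N_def by (rule prob_space.real_distribution_distr[OF prob]) (rule e)
  have "measure (N n) {-1<..1} = 1" for n
  proof -
    interpret prob_space "M n" by (rule prob)
    have "e -` {-1<..1} \<inter> space (M n) = space (M n)"
      using eC C(2) by force
    then show ?thesis unfolding N_def by (subst measure_distr) (auto simp: prob_space)
  qed
  then have "tight N"
    unfolding tight_def using realN by (intro conjI allI impI exI[of _ "-1"] exI[of _ 1]) auto
  from tight_imp_convergent_subsubsequence[OF this strict_mono_id]
  obtain s \<nu> where s: "strict_mono s" and \<nu>: "real_distribution \<nu>" and conv: "weak_conv_m (N \<circ> s) \<nu>"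
    by (auto simp: o_def)
  interpret \<nu>: real_distribution \<nu> by (rule \<nu>)
  have lim: "(\<lambda>n. \<integral>x. f (e x) \<partial>M (s n)) \<longlonglongrightarrow> integral\<^sup>L \<nu> f"
    if f: "continuous_on UNIV f" and bd: "\<And>t. \<bar>f t\<bar> \<le> B" for f :: "real \<Rightarrow> real" and B
  proof -
    have "(\<lambda>n. integral\<^sup>L ((N \<circ> s) n) f) \<longlonglongrightarrow> integral\<^sup>L \<nu> f"
      by (rule weak_conv_imp_integral_bdd_continuous_conv[OF _ \<nu> conv])
        (use f bd realN in \<open>auto simp: continuous_on_eq_continuous_at\<close>)
    moreover have "integral\<^sup>L (N n) f = (\<integral>x. f (e x) \<partial>M n)" for n
      unfolding N_def using f by (intro integral_distr e borel_measurable_continuous_onI)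
    ultimately show ?thesis by simp
  qed
  have "AE t in \<nu>. t \<in> C"
  proof -
    let ?f = "\<lambda>t. min 1 (infdist t C)"
    have cont: "continuous_on UNIV ?f" by (intro continuous_intros)
    then have [measurable]: "?f \<in> borel_measurable borel" by (rule borel_measurable_continuous_onI)
    have "(\<lambda>n. \<integral>x. ?f (e x) \<partial>M (s n)) \<longlonglongrightarrow> integral\<^sup>L \<nu> ?f"
      by (rule lim[OF cont, of 1]) (auto simp: infdist_nonneg)
    then have "integral\<^sup>L \<nu> ?f = 0"
      using eC by (simp add: LIMSEQ_const_iff)
    moreover have "integrable \<nu> ?f"
      by (rule \<nu>.integrable_const_bound[of _ 1]) (auto simp: infdist_nonneg)
    ultimately have "AE t in \<nu>. ?f t = 0"
      by (subst (asm) integral_nonneg_eq_0_iff_AE) (auto simp: infdist_nonneg)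
    then show ?thesis
      by eventually_elim (use in_closed_iff_infdist_zero[OF \<open>closed C\<close> \<open>C \<noteq> {}\<close>] in \<open>auto simp: min_def split: if_splits\<close>)
  qed
  \<comment> \<open>The value off \<open>C\<close> is arbitrary, since \<open>\<nu>\<close> does not charge the complement.\<close>
  define G where "G t = (if t \<in> C then g t else g (e undefined))" for t
  have G[measurable]: "G \<in> measurable \<nu> borel"
  proof -
    have "G \<in> borel_measurable borel"
      unfolding G_def using \<open>closed C\<close> g
      by (intro borel_measurable_continuous_on_if) auto
    then show ?thesis using measurable_cong_sets[OF \<nu>.events_eq_borel refl] by blast
  qed
  show ?thesis
  proof
    show "strict_mono s" by (rule s)
    show "prob_space (distr \<nu> borel G)" by (rule \<nu>.prob_space_distr[OF G])
    show "sets (distr \<nu> borel G) = sets borel" by simp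
    fix f :: "'a \<Rightarrow> real" assume f: "continuous_on UNIV f"
    have fg: "continuous_on C (\<lambda>t. f (g t))"
      by (rule continuous_on_compose2[OF f g]) auto
    have "bounded ((\<lambda>t. f (g t)) ` C)"
      by (intro compact_imp_bounded compact_continuous_image fg C)
    then obtain B where B: "\<And>t. t \<in> C \<Longrightarrow> norm (f (g t)) \<le> B" "0 < B"
      by (auto simp: bounded_pos)
    then obtain F where F: "continuous_on UNIV F" "\<And>t. t \<in> C \<Longrightarrow> F t = f (g t)" "\<And>t. norm (F t) \<le> B"
      using Tietze[OF fg, of UNIV B] \<open>closed C\<close> by auto
    have "(\<lambda>n. \<integral>x. F (e x) \<partial>M (s n)) \<longlonglongrightarrow> integral\<^sup>L \<nu> F"
      by (rule lim[OF F(1)]) (use F(3) in auto)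
    moreover have "F (e x) = f x" for x
      using F(2)[OF eC[rule_format]] ge by simp
    moreover have "integral\<^sup>L \<nu> F = (\<integral>t. f (G t) \<partial>\<nu>)"
    proof (rule integral_cong_AE)
      show "F \<in> borel_measurable \<nu>" using borel_measurable_continuous_onI[OF F(1)] by simp
      show "(\<lambda>t. f (G t)) \<in> borel_measurable \<nu>" by (rule borel_measurable_continuous_on[OF f G])
      show "AE t in \<nu>. F t = f (G t)"
        using \<open>AE t in \<nu>. t \<in> C\<close> by eventually_elim (simp add: F G_def)
    qed
    moreover have "integral\<^sup>L (distr \<nu> borel G) f = (\<integral>t. f (G t) \<partial>\<nu>)"
      by (intro integral_distr G borel_measurable_continuous_onI f)
    ultimately show "(\<lambda>n. integral\<^sup>L (M (s n)) f) \<longlonglongrightarrow> integral\<^sup>L (distr \<nu> borel G) f"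
      by simp
  qed
qed

text \<open>
  The indicator of a closed set \<open>F\<close> is the pointwise limit of the continuous functions
  \<open>max 0 (1 - n * infdist x F)\<close>, and closed sets form an intersection-stable generator of the Borel
  sets.
\<close>

lemma borel_prob_eqI_continuous:
  fixes M N :: "'a::metric_space measure"
  assumes "prob_space M" "prob_space N" and setsM: "sets M = sets borel" and setsN: "sets N = sets borel"
    and eq: "\<And>f :: 'a \<Rightarrow> real. continuous_on UNIV f \<Longrightarrow> (\<And>x. \<bar>f x\<bar> \<le> 1) \<Longrightarrow> integral\<^sup>L M f = integral\<^sup>L N f"
  shows "M = N"
proof -
  interpret M: prob_space M by fact
  interpret N: prob_space N by fact
  have closed_lim: "(\<lambda>n. \<integral>x. max 0 (1 - real n * infdist x F) \<partial>L) \<longlonglongrightarrow> measure L F"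
    if F: "closed F" "F \<noteq> {}" and "prob_space L" and L: "sets L = sets borel"
    for L :: "'a measure" and F
  proof -
    interpret L: prob_space L by fact
    have F_sets: "F \<in> sets L" using F by (simp add: L)
    have meas: "(\<lambda>x. max 0 (1 - real n * infdist x F)) \<in> borel_measurable L" for n
      unfolding measurable_cong_sets[OF L refl]
      by (intro borel_measurable_continuous_onI continuous_intros)
    have "(\<lambda>n. \<integral>x. max 0 (1 - real n * infdist x F) \<partial>L) \<longlonglongrightarrow> (\<integral>x. indicator F x \<partial>L)"
    proof (rule integral_dominated_convergence[where w = "\<lambda>_. 1"])
      show "indicat_real F \<in> borel_measurable L" using F_sets by simp
      show "AE x in L. (\<lambda>n. max 0 (1 - real n * infdist x F)) \<longlonglongrightarrow> indicator F x"
      proof (intro AE_I2)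
        fix x
        show "(\<lambda>n. max 0 (1 - real n * infdist x F)) \<longlonglongrightarrow> indicator F x"
        proof (cases "x \<in> F")
          case True
          then show ?thesis by simp
        next
          case False
          then have pos: "0 < infdist x F"
            using in_closed_iff_infdist_zero[OF F] infdist_nonneg[of x F] by (simp add: less_le)
          obtain k where k: "1 < real k * infdist x F"
            using reals_Archimedean3[OF pos] by blast
          have "max 0 (1 - real n * infdist x F) = 0" if "k \<le> n" for n
          proof -
            have "real k * infdist x F \<le> real n * infdist x F"
              using that pos by (intro mult_right_mono) auto
            with k show ?thesis by simp
          qed
          then have "\<forall>\<^sub>F n in sequentially. max 0 (1 - real n * infdist x F) = 0"
            by (auto simp: eventually_sequentially)
          then show ?thesis using False by (simp add: tendsto_eventually)
        qed
      qed
    qed (use meas in \<open>auto simp: infdist_nonneg\<close>)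
    also have "(\<integral>x. indicator F x \<partial>L) = measure L F" using F_sets by simp
    finally show ?thesis .
  qed
  have closed_eq: "measure M F = measure N F" if "closed F" for F
  proof (cases "F = {}")
    case False
    have "integral\<^sup>L M (\<lambda>x. max 0 (1 - real n * infdist x F)) = integral\<^sup>L N (\<lambda>x. max 0 (1 - real n * infdist x F))" for n
      by (rule eq) (auto intro!: continuous_intros simp: infdist_nonneg)
    then show ?thesis
      using closed_lim[OF that False \<open>prob_space M\<close> setsM] closed_lim[OF that False \<open>prob_space N\<close> setsN]
      by (auto intro: LIMSEQ_unique)
  qed simp
  show ?thesis
  proof (rule measure_eqI_generator_eq[where E = "Collect closed" and \<Omega> = UNIV and A = "\<lambda>_. UNIV"])
    show "Int_stable (Collect (closed :: 'a set \<Rightarrow> bool))" by (auto simp: Int_stable_def)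
    show "emeasure M X = emeasure N X" if "X \<in> Collect closed" for X
      using closed_eq that by (simp add: M.emeasure_eq_measure N.emeasure_eq_measure)
    have "sets (borel :: 'a measure) = sigma_sets UNIV (Collect closed)"
      by (subst borel_eq_closed) simp
    then show "sets M = sigma_sets UNIV (Collect closed)" "sets N = sigma_sets UNIV (Collect closed)"
      by (simp_all add: setsM setsN)
  qed auto
qed

section \<open>Maximizing measures and the gradient\<close>

lemma continuous_bounded_on_compact:
  fixes f :: "'a::metric_space \<Rightarrow> real"
  assumes "compact (UNIV :: 'a set)" "continuous_on UNIV f"
  obtains B where "\<And>x. \<bar>f x\<bar> \<le> B"
proof -
  have "bounded (range f)"
    by (intro compact_imp_bounded compact_continuous_image assms)
  then show ?thesis using that by (auto simp: bounded_iff)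
qed

lemma integrable_continuous_prob:
  fixes f :: "'a::metric_space \<Rightarrow> real"
  assumes "compact (UNIV :: 'a set)" "continuous_on UNIV f" "prob_space \<mu>" "sets \<mu> = sets borel"
  shows "integrable \<mu> f"
proof -
  interpret prob_space \<mu> by fact
  obtain B where "\<And>x. \<bar>f x\<bar> \<le> B" using continuous_bounded_on_compact assms(1,2) by blast
  moreover have "f \<in> borel_measurable \<mu>"
    using borel_measurable_continuous_onI[OF assms(2)] measurable_cong_sets[OF assms(4) refl] by blast
  ultimately show ?thesis by (intro integrable_const_bound[of _ B]) auto
qed

lemma abs_integral_le_bound:
  fixes f :: "'a::metric_space \<Rightarrow> real"
  assumes "compact (UNIV :: 'a set)" "continuous_on UNIV f" "prob_space \<mu>" "sets \<mu> = sets borel"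
    and "\<And>x. \<bar>f x\<bar> \<le> B"
  shows "\<bar>integral\<^sup>L \<mu> f\<bar> \<le> B"
proof -
  interpret prob_space \<mu> by fact
  have int: "integrable \<mu> f" by (rule integrable_continuous_prob[OF assms(1-4)])
  have "\<bar>integral\<^sup>L \<mu> f\<bar> \<le> (\<integral>x. \<bar>f x\<bar> \<partial>\<mu>)" by (rule integral_abs_bound)
  also have "\<dots> \<le> (\<integral>x. B \<partial>\<mu>)" by (intro integral_mono integrable_abs int) (use assms(5) in auto)
  also have "\<dots> = B" by (simp add: prob_space)
  finally show ?thesis .
qed

lemma invariant_probsD:
  assumes "\<mu> \<in> invariant_probs T"
  shows "prob_space \<mu>" "sets \<mu> = sets borel"
  using assms by (auto simp: invariant_probs_def)

lemma integral_minus_inner: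
  fixes \<phi> :: "'a::metric_space \<Rightarrow> real ^ 'n"
  assumes cpt: "compact (UNIV :: 'a set)" and A: "continuous_on UNIV A" and \<phi>: "continuous_on UNIV \<phi>"
    and \<mu>: "prob_space \<mu>" "sets \<mu> = sets borel"
  shows "(\<integral>z. A z - c \<bullet> \<phi> z \<partial>\<mu>) = integral\<^sup>L \<mu> A - c \<bullet> constraint_integral \<phi> \<mu>"
proof -
  have int: "integrable \<mu> (\<lambda>z. \<phi> z $ i)" for i
    by (intro integrable_continuous_prob[OF cpt _ \<mu>] continuous_intros \<phi>)
  have "(\<integral>z. A z - c \<bullet> \<phi> z \<partial>\<mu>) = integral\<^sup>L \<mu> A - (\<integral>z. c \<bullet> \<phi> z \<partial>\<mu>)"
    by (intro Bochner_Integration.integral_diff integrable_continuous_prob[OF cpt _ \<mu>] continuous_intros A \<phi>)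
  also have "(\<integral>z. c \<bullet> \<phi> z \<partial>\<mu>) = (\<Sum>i\<in>UNIV. \<integral>z. c $ i * \<phi> z $ i \<partial>\<mu>)"
    unfolding inner_vec_def inner_real_def by (intro Bochner_Integration.integral_sum integrable_mult_right int)
  also have "\<dots> = c \<bullet> constraint_integral \<phi> \<mu>"
    by (simp add: inner_vec_def constraint_integral_def)
  finally show ?thesis .
qed

lemma integral_le_ergodic_max:
  fixes B :: "'a::metric_space \<Rightarrow> real"
  assumes "compact (UNIV :: 'a set)" "continuous_on UNIV B" "\<mu> \<in> invariant_probs T"
  shows "integral\<^sup>L \<mu> B \<le> ergodic_max T B"
proof -
  obtain b where b: "\<And>x. \<bar>B x\<bar> \<le> b" using continuous_bounded_on_compact assms(1,2) by blast
  have "integral\<^sup>L \<nu> B \<le> b" if "\<nu> \<in> invariant_probs T" for \<nu>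
    using abs_integral_le_bound[OF assms(1,2) invariant_probsD[OF that] b] by linarith
  then have "bdd_above ((\<lambda>\<nu>. integral\<^sup>L \<nu> B) ` invariant_probs T)" by (rule bdd_aboveI2)
  then show ?thesis unfolding ergodic_max_def by (intro cSUP_upper assms(3))
qed

text \<open>
  Splitting the maximization of \<open>A - c \<bullet> \<phi>\<close> over all invariant measures according to the value of
  \<open>constraint_integral \<phi>\<close>, on whose fibres \<open>c \<bullet> \<phi>\<close> has constant integral, yields \<open>constrained_alpha\<close>
  up to sign: it is the concave conjugate of \<open>constrained_beta\<close>.
\<close>

lemma constrained_alpha_eq_ergodic_max:
  fixes A :: "'a::metric_space \<Rightarrow> real" and \<phi> :: "'a \<Rightarrow> real ^ 'n"
  assumes cpt: "compact (UNIV :: 'a set)" and A: "continuous_on UNIV A" and \<phi>: "continuous_on UNIV \<phi>"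
    and ne: "invariant_probs T \<noteq> {}"
  shows "constrained_alpha T A \<phi> c = - ergodic_max T (\<lambda>z. A z - c \<bullet> \<phi> z)"
proof -
  let ?B = "\<lambda>z. A z - c \<bullet> \<phi> z"
  let ?h = "constraint_integral \<phi>"
  have B: "continuous_on UNIV ?B" by (intro continuous_intros A \<phi>)
  obtain a where a: "\<And>x. \<bar>A x\<bar> \<le> a" using continuous_bounded_on_compact cpt A by blast
  have intB: "integral\<^sup>L \<mu> ?B = integral\<^sup>L \<mu> A - c \<bullet> ?h \<mu>" if "\<mu> \<in> invariant_probs T" for \<mu>
    by (rule integral_minus_inner[OF cpt A \<phi> invariant_probsD[OF that]])
  have beta_ge: "integral\<^sup>L \<mu> A \<le> constrained_beta T A \<phi> (?h \<mu>)" if "\<mu> \<in> invariant_probs T" for \<mu>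
  proof -
    have "integral\<^sup>L \<nu> A \<le> a" if "\<nu> \<in> invariant_probs T" for \<nu>
      using abs_integral_le_bound[OF cpt A invariant_probsD[OF that] a] by linarith
    then have "bdd_above ((\<lambda>\<nu>. integral\<^sup>L \<nu> A) ` {\<nu> \<in> invariant_probs T. ?h \<nu> = ?h \<mu>})"
      by (intro bdd_aboveI2[where M = a]) auto
    then show ?thesis
      unfolding constrained_beta_def by (intro cSUP_upper) (use that in auto)
  qed
  have lower: "- ergodic_max T ?B \<le> c \<bullet> ?h \<mu> - constrained_beta T A \<phi> (?h \<mu>)"
    if \<mu>: "\<mu> \<in> invariant_probs T" for \<mu>
  proof -
    have "constrained_beta T A \<phi> (?h \<mu>) \<le> c \<bullet> ?h \<mu> + ergodic_max T ?B"
      unfolding constrained_beta_def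
    proof (rule cSUP_least)
      show "{\<nu> \<in> invariant_probs T. ?h \<nu> = ?h \<mu>} \<noteq> {}" using \<mu> by blast
      show "integral\<^sup>L \<nu> A \<le> c \<bullet> ?h \<mu> + ergodic_max T ?B"
        if "\<nu> \<in> {\<nu> \<in> invariant_probs T. ?h \<nu> = ?h \<mu>}" for \<nu>
        using that intB[of \<nu>] integral_le_ergodic_max[OF cpt B, of \<nu> T] by auto
    qed
    then show ?thesis by simp
  qed
  show ?thesis
  proof (rule antisym)
    have bdd: "bdd_below ((\<lambda>h. c \<bullet> h - constrained_beta T A \<phi> h) ` ?h ` invariant_probs T)"
      using lower by (auto intro!: bdd_belowI2[where m = "- ergodic_max T ?B"])
    have "integral\<^sup>L \<mu> ?B \<le> - constrained_alpha T A \<phi> c" if \<mu>: "\<mu> \<in> invariant_probs T" for \<mu>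
    proof -
      have "constrained_alpha T A \<phi> c \<le> c \<bullet> ?h \<mu> - constrained_beta T A \<phi> (?h \<mu>)"
        unfolding constrained_alpha_def using \<mu> by (intro cINF_lower bdd) auto
      with beta_ge[OF \<mu>] intB[OF \<mu>] show ?thesis by linarith
    qed
    then have "ergodic_max T ?B \<le> - constrained_alpha T A \<phi> c"
      unfolding ergodic_max_def by (intro cSUP_least ne)
    then show "constrained_alpha T A \<phi> c \<le> - ergodic_max T ?B" by simp
    show "- ergodic_max T ?B \<le> constrained_alpha T A \<phi> c"
      unfolding constrained_alpha_def using ne lower by (intro cINF_greatest) auto
  qed
qed

text \<open>
  The difference of the function and its affine majorant has a global maximum at \<open>c\<close>.
\<close>

lemma gradient_eq_supergradient:
  fixes f :: "'v::euclidean_space \<Rightarrow> real"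
  assumes "f differentiable (at c)" and super: "\<And>y. f y \<le> f c + (y - c) \<bullet> h"
  shows "gradient f c = h"
proof -
  obtain f' where f': "(f has_derivative f') (at c)"
    using assms(1) unfolding differentiable_def by blast
  have "((\<lambda>y. f y - (y - c) \<bullet> h) has_derivative (\<lambda>v. f' v - v \<bullet> h)) (at c)"
    using f' by (auto intro!: derivative_eq_intros)
  then have "(\<lambda>v. f' v - v \<bullet> h) = (\<lambda>v. 0)"
    by (rule differential_zero_maxmin[OF UNIV_I open_UNIV]) (use super in \<open>auto simp: algebra_simps\<close>)
  then have "f' = (\<lambda>v. v \<bullet> h)" by (metis eq_iff_diff_eq_0)
  with f' have "GDERIV f c :> h" by (simp add: gderiv_def)
  then show ?thesis by (rule gradient_eqI)
qed

text \<open>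
  A measure \<open>\<mu>\<close> that maximizes \<open>A - c \<bullet> \<phi>\<close> is still a competitor for every other parameter \<open>c'\<close>.
  Hence \<open>c' \<mapsto> c' \<bullet> constraint_integral \<phi> \<mu> - integral\<^sup>L \<mu> A\<close> is an affine majorant of
  \<open>constrained_alpha\<close>, with equality at \<open>c\<close>.
\<close>

lemma maximizing_integral_eq_gradient:
  fixes A :: "'a::metric_space \<Rightarrow> real" and \<phi> :: "'a \<Rightarrow> real ^ 'n"
  assumes cpt: "compact (UNIV :: 'a set)" and A: "continuous_on UNIV A" and \<phi>: "continuous_on UNIV \<phi>"
    and diff: "constrained_alpha T A \<phi> differentiable (at c)"
    and \<mu>: "\<mu> \<in> invariant_probs T"
    and max: "(\<integral>z. A z - c \<bullet> \<phi> z \<partial>\<mu>) = ergodic_max T (\<lambda>z. A z - c \<bullet> \<phi> z)"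
  shows "constraint_integral \<phi> \<mu> = gradient (constrained_alpha T A \<phi>) c"
proof (rule gradient_eq_supergradient[OF diff, symmetric])
  fix c'
  have \<alpha>: "constrained_alpha T A \<phi> b = - ergodic_max T (\<lambda>z. A z - b \<bullet> \<phi> z)" for b
    using \<mu> by (intro constrained_alpha_eq_ergodic_max[OF cpt A \<phi>]) auto
  have int: "(\<integral>z. A z - b \<bullet> \<phi> z \<partial>\<mu>) = integral\<^sup>L \<mu> A - b \<bullet> constraint_integral \<phi> \<mu>" for b
    by (rule integral_minus_inner[OF cpt A \<phi> invariant_probsD[OF \<mu>]])
  have "(\<integral>z. A z - c' \<bullet> \<phi> z \<partial>\<mu>) \<le> ergodic_max T (\<lambda>z. A z - c' \<bullet> \<phi> z)"
    by (intro integral_le_ergodic_max cpt \<mu> continuous_intros A \<phi>)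
  then show "constrained_alpha T A \<phi> c' \<le> constrained_alpha T A \<phi> c + (c' - c) \<bullet> constraint_integral \<phi> \<mu>"
    using max int[of c] int[of c'] by (simp add: \<alpha> inner_diff_left)
qed


section \<open>Empirical measures of optimal trajectories\<close>

definition empirical_measure :: "(nat \<Rightarrow> 'a::topological_space) \<Rightarrow> nat \<Rightarrow> 'a measure" where
  "empirical_measure x k = distr (uniform_count_measure {..<k}) borel x"

lemma sets_empirical_measure [simp]: "sets (empirical_measure x k) = sets borel"
  by (simp add: empirical_measure_def)

lemma prob_space_empirical_measure: "0 < k \<Longrightarrow> prob_space (empirical_measure x k)"
  unfolding empirical_measure_def
  by (intro prob_space.prob_space_distr prob_space_uniform_count_measure)
    (auto simp: measurable_def space_uniform_count_measure sets_uniform_count_measure)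

lemma integral_empirical_measure:
  fixes f :: "'a::topological_space \<Rightarrow> real"
  assumes "continuous_on UNIV f"
  shows "integral\<^sup>L (empirical_measure x k) f = (\<Sum>j<k. f (x j)) / k"
proof -
  have "x \<in> measurable (uniform_count_measure {..<k}) borel"
    by (auto simp: measurable_def space_uniform_count_measure sets_uniform_count_measure)
  from integral_distr[OF this borel_measurable_continuous_onI[OF assms]] show ?thesis
    by (simp add: empirical_measure_def integral_uniform_count_measure)
qed

text \<open>
  Along a backward orbit \<open>T\<close> shifts the index down by one, so the sums of \<open>f \<circ> T\<close> and of \<open>f\<close> differ
  only by two boundary terms, which the averaging removes.
\<close>

lemma backward_orbit_limit_integral_invariant:
  fixes f :: "'a::topological_space \<Rightarrow> real"
  assumes orbit: "\<And>j. T (x (Suc j)) = x j" and t: "filterlim t at_top sequentially"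
    and bd: "\<And>z. \<bar>f z\<bar> \<le> b"
    and a: "(\<lambda>n. (\<Sum>j<t n. f (T (x j))) / real (t n)) \<longlonglongrightarrow> a"
    and a': "(\<lambda>n. (\<Sum>j<t n. f (x j)) / real (t n)) \<longlonglongrightarrow> a'"
  shows "a = a'"
proof -
  have tele: "\<bar>(\<Sum>j<k. f (T (x j))) - (\<Sum>j<k. f (x j))\<bar> \<le> 2 * b" for k
  proof (cases k)
    case 0
    then show ?thesis using order_trans[OF abs_ge_zero bd[of "x 0"]] by simp
  next
    case (Suc m)
    have "(\<Sum>j<k. f (T (x j))) = f (T (x 0)) + (\<Sum>j<m. f (x j))"
      unfolding Suc by (subst sum.lessThan_Suc_shift) (simp add: orbit)
    moreover have "(\<Sum>j<k. f (x j)) = (\<Sum>j<m. f (x j)) + f (x m)" by (simp add: Suc)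
    ultimately show ?thesis using bd[of "T (x 0)"] bd[of "x m"] by linarith
  qed
  have "(\<lambda>n. (\<Sum>j<t n. f (T (x j))) / real (t n) - (\<Sum>j<t n. f (x j)) / real (t n)) \<longlonglongrightarrow> 0"
  proof (rule Lim_null_comparison)
    show "\<forall>\<^sub>F n in sequentially. norm ((\<Sum>j<t n. f (T (x j))) / real (t n) - (\<Sum>j<t n. f (x j)) / real (t n))
        \<le> 2 * b / real (t n)"
      by (intro always_eventually allI)
        (simp add: diff_divide_distrib[symmetric] divide_right_mono tele)
    show "(\<lambda>n. 2 * b / real (t n)) \<longlonglongrightarrow> 0"
      by (intro tendsto_divide_0[OF tendsto_const] filterlim_at_top_imp_at_infinity
          filterlim_compose[OF filterlim_real_sequentially t])
  qed
  moreover have "(\<lambda>n. (\<Sum>j<t n. f (T (x j))) / real (t n) - (\<Sum>j<t n. f (x j)) / real (t n)) \<longlonglongrightarrow> a - a'"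
    by (rule tendsto_diff[OF a a'])
  ultimately show ?thesis using LIMSEQ_unique by force
qed

lemma backward_orbit_limit_invariant:
  fixes T :: "'a::metric_space \<Rightarrow> 'a"
  assumes T: "continuous_on UNIV T" and orbit: "\<And>j. T (x (Suc j)) = x j"
    and t: "filterlim t at_top sequentially"
    and \<mu>: "prob_space \<mu>" "sets \<mu> = sets borel"
    and lim: "\<And>f :: 'a \<Rightarrow> real. continuous_on UNIV f \<Longrightarrow>
        (\<lambda>n. (\<Sum>j<t n. f (x j)) / real (t n)) \<longlonglongrightarrow> integral\<^sup>L \<mu> f"
  shows "\<mu> \<in> invariant_probs T"
proof -
  have T_meas: "T \<in> measurable \<mu> borel"
    using borel_measurable_continuous_onI[OF T] measurable_cong_sets[OF \<mu>(2) refl] by blast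
  have "distr \<mu> borel T = \<mu>"
  proof (rule borel_prob_eqI_continuous)
    show "prob_space (distr \<mu> borel T)" by (rule prob_space.prob_space_distr[OF \<mu>(1) T_meas])
    fix f :: "'a \<Rightarrow> real" assume f: "continuous_on UNIV f" and bd: "\<And>x. \<bar>f x\<bar> \<le> 1"
    have "integral\<^sup>L (distr \<mu> borel T) f = (\<integral>z. f (T z) \<partial>\<mu>)"
      by (intro integral_distr T_meas borel_measurable_continuous_onI f)
    also have "\<dots> = integral\<^sup>L \<mu> f"
      by (rule backward_orbit_limit_integral_invariant[where T = T and x = x and f = f, OF orbit t bd])
        (intro lim f continuous_on_compose2[OF f T] subset_UNIV)+
    finally show "integral\<^sup>L (distr \<mu> borel T) f = integral\<^sup>L \<mu> f" .
  qed (simp_all add: \<mu>)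
  then have "emeasure \<mu> (T -` E) = emeasure \<mu> E" if "E \<in> sets borel" for E
    using emeasure_distr[OF T_meas that] sets_eq_imp_space_eq[OF \<mu>(2)] by simp
  with \<mu> show ?thesis by (simp add: invariant_probs_def)
qed

lemma integral_comp_invariant:
  fixes f :: "'a::metric_space \<Rightarrow> real"
  assumes T: "continuous_on UNIV T" and f: "continuous_on UNIV f" and \<mu>: "\<mu> \<in> invariant_probs T"
  shows "(\<integral>z. f (T z) \<partial>\<mu>) = integral\<^sup>L \<mu> f"
proof -
  note sets = invariant_probsD(2)[OF \<mu>]
  have T_meas: "T \<in> measurable \<mu> borel"
    using borel_measurable_continuous_onI[OF T] measurable_cong_sets[OF sets refl] by blast
  have "distr \<mu> borel T = \<mu>"
    using \<mu> sets_eq_imp_space_eq[OF sets]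
    by (intro measure_eqI) (auto simp: sets emeasure_distr[OF T_meas] invariant_probs_def)
  then show ?thesis
    using integral_distr[OF T_meas borel_measurable_continuous_onI[OF f]] by simp
qed

text \<open>
  The function \<open>B + u - u \<circ> T\<close> takes the value \<open>ergodic_max T B\<close> at every point of the trajectory
  except possibly the initial one, so its averages converge to this value. Under an invariant
  measure the coboundary \<open>u - u \<circ> T\<close> integrates to zero, and only the integral of \<open>B\<close> is left.
\<close>

lemma optimal_trajectory_limit_maximizing:
  fixes T :: "'a::metric_space \<Rightarrow> 'a"
  assumes cpt: "compact (UNIV :: 'a set)" and T: "continuous_on UNIV T" and B: "continuous_on UNIV B"
    and traj: "optimal_trajectory T B x"
    and t: "filterlim t at_top sequentially"
    and \<mu>: "prob_space \<mu>" "sets \<mu> = sets borel"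
    and lim: "\<And>f :: 'a \<Rightarrow> real. continuous_on UNIV f \<Longrightarrow>
        (\<lambda>n. (\<Sum>j<t n. f (x j)) / real (t n)) \<longlonglongrightarrow> integral\<^sup>L \<mu> f"
  shows "\<mu> \<in> invariant_probs T" "integral\<^sup>L \<mu> B = ergodic_max T B"
proof -
  obtain u where u: "continuous_on UNIV u" and orbit: "\<And>j. T (x (Suc j)) = x j"
    and opt: "\<And>j. u (x j) = B (x (Suc j)) + u (x (Suc j)) - ergodic_max T B"
    using traj by (auto simp: optimal_trajectory_def calibrated_subaction_def)
  show inv: "\<mu> \<in> invariant_probs T"
    by (rule backward_orbit_limit_invariant[OF T orbit t \<mu> lim])
  define m where "m = ergodic_max T B"
  define F where "F z = B z + u z - u (T z)" for z
  have uT: "continuous_on UNIV (\<lambda>z. u (T z))" by (rule continuous_on_compose2[OF u T]) simp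
  have F: "continuous_on UNIV F" unfolding F_def by (intro continuous_intros B u uT)
  have FS: "F (x (Suc j)) = m" for j
    using opt[of j] by (simp add: F_def orbit m_def)
  have avg: "(\<Sum>j<k. F (x j)) / real k = m + (F (x 0) - m) / real k" if "0 < k" for k
  proof -
    obtain i where k: "k = Suc i" using \<open>0 < k\<close> by (cases k) auto
    have "(\<Sum>j<k. F (x j)) = F (x 0) + real i * m"
      unfolding k by (subst sum.lessThan_Suc_shift) (simp add: FS)
    then show ?thesis by (simp add: k field_simps)
  qed
  have "(\<lambda>n. m + (F (x 0) - m) / real (t n)) \<longlonglongrightarrow> m + 0"
    by (intro tendsto_add tendsto_const tendsto_divide_0[OF tendsto_const] filterlim_at_top_imp_at_infinity
        filterlim_compose[OF filterlim_real_sequentially t])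
  moreover have "\<forall>\<^sub>F n in sequentially. (\<Sum>j<t n. F (x j)) / real (t n) = m + (F (x 0) - m) / real (t n)"
    using filterlim_at_top[THEN iffD1, OF t, rule_format, of 1] by eventually_elim (simp add: avg)
  ultimately have "(\<lambda>n. (\<Sum>j<t n. F (x j)) / real (t n)) \<longlonglongrightarrow> m"
    by (simp add: tendsto_cong)
  then have "integral\<^sup>L \<mu> F = m" using lim[OF F] LIMSEQ_unique by blast
  moreover have "integral\<^sup>L \<mu> F = integral\<^sup>L \<mu> B + integral\<^sup>L \<mu> u - (\<integral>z. u (T z) \<partial>\<mu>)"
    unfolding F_def using integrable_continuous_prob[OF cpt _ \<mu>] B u uT by simp
  ultimately show "integral\<^sup>L \<mu> B = ergodic_max T B"
    using integral_comp_invariant[OF T u inv] by (simp add: m_def)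
qed

theorem theorem17:
  fixes T :: "'a::metric_space \<Rightarrow> 'a"
    and A :: "'a \<Rightarrow> real"
    and \<phi> :: "'a \<Rightarrow> real ^ 'n"
    and c :: "real ^ 'n"
    and x :: "nat \<Rightarrow> 'a"
  assumes "compact (UNIV :: 'a set)"
    and "continuous_on UNIV T"
    and "transitive_map T"
    and "weakly_expanding T"
    and "walters_function T A"
    and "walters_constraint T \<phi>"
    and "optimal_trajectory T (\<lambda>z. A z - c \<bullet> \<phi> z) x"
    and "constrained_alpha T A \<phi> differentiable (at c)"
  shows "(\<lambda>k. (1 / real k) *\<^sub>R (\<Sum>j<k. \<phi> (x j)))
           \<longlonglongrightarrow> gradient (constrained_alpha T A \<phi>) c"
proof (rule ccontr)
  let ?v = "\<lambda>k. (1 / real k) *\<^sub>R (\<Sum>j<k. \<phi> (x j))"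
  let ?D = "gradient (constrained_alpha T A \<phi>) c"
  assume "\<not> ?v \<longlonglongrightarrow> ?D"
  then obtain e where "0 < e" and "\<not> (\<forall>\<^sub>F k in sequentially. dist (?v k) ?D < e)"
    by (auto simp: tendsto_iff)
  then have "infinite {k. e \<le> dist (?v k) ?D}"
    by (simp add: cofinite_eq_sequentially[symmetric] eventually_cofinite not_less)
  then obtain s :: "nat \<Rightarrow> nat" where s: "strict_mono s" and far: "\<And>n. e \<le> dist (?v (s n)) ?D"
    by (metis (mono_tags, lifting) infinite_enumerate mem_Collect_eq)
  have A: "continuous_on UNIV A" and \<phi>: "continuous_on UNIV \<phi>"
    using assms(5,6) by (auto simp: walters_function_def walters_constraint_def)
  \<comment> \<open>The index is shifted by one because \<open>s 0\<close> may be 0, and the empty average is no measure.\<close>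
  have pos: "0 < s (Suc n)" for n
    using strict_mono_less[OF s, of n "Suc n"] by linarith
  obtain r \<mu> where r: "strict_mono (r :: nat \<Rightarrow> nat)" and \<mu>: "prob_space \<mu>" "sets \<mu> = sets borel"
    and conv: "\<And>f :: 'a \<Rightarrow> real. continuous_on UNIV f \<Longrightarrow>
      (\<lambda>n. integral\<^sup>L (empirical_measure x (s (Suc (r n)))) f) \<longlonglongrightarrow> integral\<^sup>L \<mu> f"
    by (rule weakly_convergent_subsequence[of "\<lambda>n. empirical_measure x (s (Suc n))"])
      (auto simp: assms(1) pos prob_space_empirical_measure)
  define t where "t n = s (Suc (r n))" for n
  have t: "filterlim t at_top sequentially"
    using s r by (intro filterlim_subseq) (simp add: t_def strict_mono_def)
  have lim: "(\<lambda>n. (\<Sum>j<t n. f (x j)) / real (t n)) \<longlonglongrightarrow> integral\<^sup>L \<mu> f"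
    if "continuous_on UNIV f" for f :: "'a \<Rightarrow> real"
    using conv[OF that] by (simp add: integral_empirical_measure[OF that] t_def)
  have "continuous_on UNIV (\<lambda>z. A z - c \<bullet> \<phi> z)" by (intro continuous_intros A \<phi>)
  note max = optimal_trajectory_limit_maximizing[OF assms(1,2) this assms(7) t \<mu> lim]
  have "(\<lambda>n. ?v (t n)) \<longlonglongrightarrow> constraint_integral \<phi> \<mu>"
  proof (rule vec_tendstoI)
    fix i
    have "(\<lambda>n. (\<Sum>j<t n. \<phi> (x j) $ i) / real (t n)) \<longlonglongrightarrow> (\<integral>z. \<phi> z $ i \<partial>\<mu>)"
      by (intro lim continuous_intros \<phi>)
    then show "(\<lambda>n. ?v (t n) $ i) \<longlonglongrightarrow> constraint_integral \<phi> \<mu> $ i"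
      by (simp add: constraint_integral_def)
  qed
  then have "(\<lambda>n. ?v (t n)) \<longlonglongrightarrow> ?D"
    using maximizing_integral_eq_gradient[OF assms(1) A \<phi> assms(8) max] by simp
  then have "\<forall>\<^sub>F n in sequentially. dist (?v (t n)) ?D < e"
    using \<open>0 < e\<close> by (simp add: tendsto_iff)
  then show False
    using far by (auto simp: t_def not_less[symmetric])
qed

end
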